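(* Let $n\ge2$. If $\pi\in\mathcal S_n(132,213)$ has $\kappa(\pi)=(a_1,a_2)$, then $\pi\in\mathcal C_n(132,213)$ if and only if $\gcd(a_1,a_2)=1$. As a result, the number of Grassmannian $\pi\in\mathcal C_n(132,213)$ is $\phi(n)$, where $\phi$ is Euler's totient function.
   Context: $\mathcal S_n(132,213)$ is the set of permutations of $\{1,\dots,n\}$ which, in one-line notation, avoid the patterns $132$ and $213$; $\mathcal C_n(132,213)$ is the subset of those that are cyclic, i.e. whose cycle decomposition is a single cycle of length $n$. For $\sigma\in\mathcal S_p$ and $\tau\in\mathcal S_q$, the skew sum is $\sigma\ominus\tau=(\sigma_1+q)\cdots(\sigma_p+q)\,\tau_1\cdots\tau_q$, and $\mathrm{id}_a=12\cdots a$. Every $\pi\in\mathcal S_n(132,213)$ is uniquely of the form $\mathrm{id}_{a_1}\ominus\cdots\ominus\mathrm{id}_{a_k}$ with $(a_1,\dots,a_k)$ a composition of $n$ (a tuple of positive integers with sum $n$); write $\kappa(\pi)=(a_1,\dots,a_k)$. A permutation is Grassmannian if it has at most one descent. *)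

theory Defs
  imports
    "HOL-Combinatorics.Combinatorics"
    "HOL-Library.Sublist"
    "HOL-Number_Theory.Totient"
begin

text \<open>
  A permutation of size \<open>n\<close> is a function \<open>\<pi>\<close> with \<open>\<pi> permutes {1..n}\<close>. Since such a function
  is the identity outside \<open>{1..n}\<close>, it does not determine \<open>n\<close>, which is therefore passed along.
\<close>

definition one_line :: "nat \<Rightarrow> (nat \<Rightarrow> nat) \<Rightarrow> nat list" where
  "one_line n \<pi> = map \<pi> [1..<Suc n]"

definition order_isomorphic :: "nat list \<Rightarrow> nat list \<Rightarrow> bool" where
  "order_isomorphic xs ys \<longleftrightarrow> length xs = length ys \<and>
     (\<forall>i<length xs. \<forall>j<length xs. xs ! i < xs ! j \<longleftrightarrow> ys ! i < ys ! j)"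

definition contains_pattern :: "nat list \<Rightarrow> nat list \<Rightarrow> bool" where
  "contains_pattern w p \<longleftrightarrow> (\<exists>v. subseq v w \<and> order_isomorphic v p)"

definition avoiding_perms :: "nat \<Rightarrow> nat list set \<Rightarrow> (nat \<Rightarrow> nat) set" where
  "avoiding_perms n P =
     {\<pi>. \<pi> permutes {1..n} \<and> (\<forall>p\<in>P. \<not> contains_pattern (one_line n \<pi>) p)}"

definition cyclic_avoiding_perms :: "nat \<Rightarrow> nat list set \<Rightarrow> (nat \<Rightarrow> nat) set" where
  "cyclic_avoiding_perms n P = {\<pi> \<in> avoiding_perms n P. cyclic_on \<pi> {1..n}}"

definition skew_sum :: "nat list \<Rightarrow> nat list \<Rightarrow> nat list" (infixr "\<ominus>" 65) where
  "\<sigma> \<ominus> \<tau> = map (\<lambda>x. x + length \<tau>) \<sigma> @ \<tau>"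

definition id_word :: "nat \<Rightarrow> nat list" where
  "id_word a = [1..<Suc a]"

definition composition_of :: "nat list \<Rightarrow> nat \<Rightarrow> bool" where
  "composition_of as n \<longleftrightarrow> (\<forall>a\<in>set as. a > 0) \<and> sum_list as = n"

text \<open>
  The empty word is neutral for the skew sum, so the fold below is the skew sum of the words
  \<open>id_word a\<close> over the entries of \<open>as\<close>. The description is only meaningful for permutations
  avoiding both 132 and 213: exactly for these there is such a composition, and it is unique.
\<close>

definition kappa :: "nat \<Rightarrow> (nat \<Rightarrow> nat) \<Rightarrow> nat list" where
  "kappa n \<pi> = (THE as. composition_of as n \<and>
                   one_line n \<pi> = foldr (\<ominus>) (map id_word as) [])"

definition descents :: "nat \<Rightarrow> (nat \<Rightarrow> nat) \<Rightarrow> nat set" where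
  "descents n \<pi> = {i. 1 \<le> i \<and> i < n \<and> \<pi> i > \<pi> (i + 1)}"

definition grassmannian :: "nat \<Rightarrow> (nat \<Rightarrow> nat) \<Rightarrow> bool" where
  "grassmannian n \<pi> \<longleftrightarrow> card (descents n \<pi>) \<le> 1"

end

theory Submission
  imports Defs
begin

text \<open>
  In a word avoiding both 132 and 213, whenever an entry \<open>x\<close> precedes a larger entry \<open>z\<close>, every
  entry between them in position is also between them in value; conversely this property rules
  out both patterns (\<open>avoids_both_iff_no_excursion\<close>). Splitting such a word after its maximal
  entry peels off one block \<open>id\<^sub>a\<close> of a skew sum, so the avoiding permutations are exactly the
  layered words (\<open>no_excursion_imp_layered\<close>, \<open>no_excursion_layered\<close>). The layers are recovered
  from the first entries and the lengths, so \<open>kappa\<close> is well defined (\<open>kappa_eqD\<close>).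

  The layered word with two layers \<open>a, b\<close> is the one-line notation of the rotation
  \<open>i \<mapsto> i + b\<close> of \<open>\<int>/n\<close>, where \<open>n = a + b\<close>. Its powers are the rotations by multiples of \<open>b\<close>,
  so it is a single cycle iff \<open>b\<close> generates \<open>\<int>/n\<close>, that is, iff \<open>gcd b n = gcd a b = 1\<close>
  (\<open>cyclic_rotation_iff\<close>). Each boundary between layers is a descent, so a Grassmannian layered
  permutation has at most two layers and is a rotation. Hence the Grassmannian cyclic ones
  correspond bijectively to the residues \<open>b\<close> coprime to \<open>n\<close>.
\<close>

section \<open>Simultaneous avoidance of 132 and 213\<close>

definition no_excursion :: "nat list \<Rightarrow> bool" where
  "no_excursion w \<longleftrightarrow> (\<forall>x y z. subseq [x, y, z] w \<longrightarrow> x < z \<longrightarrow> x \<le> y \<and> y \<le> z)"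

lemma order_isomorphic_132_iff:
  "order_isomorphic v [1, 3, 2] \<longleftrightarrow> (\<exists>x y z. v = [x, y, z] \<and> x < z \<and> z < y)"
  unfolding order_isomorphic_def
  by (cases v rule: list.exhaust; cases "tl v" rule: list.exhaust;
      cases "tl (tl v)" rule: list.exhaust)
     (auto simp: All_less_Suc numeral_eq_Suc)

lemma order_isomorphic_213_iff:
  "order_isomorphic v [2, 1, 3] \<longleftrightarrow> (\<exists>x y z. v = [x, y, z] \<and> y < x \<and> x < z)"
  unfolding order_isomorphic_def
  by (cases v rule: list.exhaust; cases "tl v" rule: list.exhaust;
      cases "tl (tl v)" rule: list.exhaust)
     (auto simp: All_less_Suc numeral_eq_Suc)

text \<open>
  The patterns 132 and 213 are the two ways in which the middle entry of an increasing pair can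
  escape the interval spanned by the pair: above it or below it.
\<close>

lemma avoids_both_iff_no_excursion:
  "(\<forall>p\<in>{[1, 3, 2], [2, 1, 3]}. \<not> contains_pattern w p) \<longleftrightarrow> no_excursion w"
proof -
  have "contains_pattern w [1, 3, 2] \<longleftrightarrow> (\<exists>x y z. subseq [x, y, z] w \<and> x < z \<and> z < y)"
    unfolding contains_pattern_def order_isomorphic_132_iff by blast
  moreover have "contains_pattern w [2, 1, 3] \<longleftrightarrow> (\<exists>x y z. subseq [x, y, z] w \<and> y < x \<and> x < z)"
    unfolding contains_pattern_def order_isomorphic_213_iff by blast
  ultimately show ?thesis
    unfolding no_excursion_def ball_simps by (meson linorder_not_le)
qed

lemma no_excursion_subseq:
  assumes "no_excursion w" "subseq v w"
  shows "no_excursion v"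
  using assms subseq_order.trans unfolding no_excursion_def by blast

lemma no_excursion_sorted:
  assumes "sorted w"
  shows "no_excursion w"
  unfolding no_excursion_def
proof (intro allI impI)
  fix x y z
  assume "subseq [x, y, z] w"
  then have "sorted [x, y, z]"
    using assms by (auto simp only: subseq_conv_nths sorted_nths)
  then show "x \<le> y \<and> y \<le> z"
    by simp
qed

text \<open>
  Both patterns begin with a smaller entry than they end with, so no occurrence can straddle the
  two summands of a skew sum.
\<close>

lemma no_excursion_append:
  assumes "no_excursion us" "no_excursion vs" "\<forall>u\<in>set us. \<forall>v\<in>set vs. v < u"
  shows "no_excursion (us @ vs)"
  unfolding no_excursion_def
proof (intro allI impI)
  fix x y z
  assume sub: "subseq [x, y, z] (us @ vs)" and "x < z"
  from sub obtain ps qs where *: "[x, y, z] = ps @ qs" "subseq ps us" "subseq qs vs"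
    by (auto simp: subseq_append_iff)
  have "set ps \<subseteq> set us" "set qs \<subseteq> set vs"
    using *(2,3) by (auto dest: list_emb_set)
  moreover have "\<not> (x \<in> set us \<and> z \<in> set vs)"
    using assms(3) \<open>x < z\<close> by fastforce
  ultimately have "ps = [] \<or> qs = []"
    using *(1) by (auto simp: Cons_eq_append_conv)
  then have "subseq [x, y, z] us \<or> subseq [x, y, z] vs"
    using * by auto
  then show "x \<le> y \<and> y \<le> z"
    using assms(1,2) \<open>x < z\<close> unfolding no_excursion_def by blast
qed

section \<open>Layered words\<close>

definition layered :: "nat list \<Rightarrow> nat list" where
  "layered cs = foldr (\<ominus>) (map id_word cs) []"

lemma length_skew_sum [simp]: "length (us \<ominus> vs) = length us + length vs"
  by (simp add: skew_sum_def)

lemma layered_Nil [simp]: "layered [] = []"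
  by (simp add: layered_def)

lemma length_layered [simp]: "length (layered cs) = sum_list cs"
  by (induction cs) (simp_all add: layered_def id_word_def)

lemma layered_Cons:
  "layered (c # cs) = [Suc (sum_list cs)..<Suc (sum_list cs + c)] @ layered cs"
proof -
  have "layered (c # cs) = id_word c \<ominus> layered cs"
    by (simp add: layered_def)
  moreover have "map (\<lambda>x. x + m) [1..<Suc c] = [Suc m..<Suc (m + c)]" for m
    by (rule nth_equalityI) (auto simp del: upt_Suc)
  ultimately show ?thesis
    by (simp add: skew_sum_def id_word_def del: upt_Suc)
qed

lemma set_layered: "set (layered cs) = {1..sum_list cs}"
  by (induction cs) (auto simp: layered_Cons simp del: upt_Suc)

lemma no_excursion_layered: "no_excursion (layered cs)"
proof (induction cs)
  case Nil
  show ?case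
    by (simp add: no_excursion_sorted)
next
  case (Cons c cs)
  then show ?case
    unfolding layered_Cons
    by (intro no_excursion_append no_excursion_sorted[OF sorted_upt])
       (auto simp: set_layered simp del: upt_Suc)
qed

text \<open>
  The first entry of a layered word exceeds the sum of the remaining layers by one, and the
  length is the sum of all layers; together they determine the first layer.
\<close>

lemma layered_inj:
  assumes "\<forall>c\<in>set cs. c > 0" "\<forall>d\<in>set ds. d > 0" "layered cs = layered ds"
  shows "cs = ds"
  using assms
proof (induction cs arbitrary: ds)
  case Nil
  then have "sum_list ds = 0"
    by (metis layered_Nil length_layered sum_list.Nil)
  with Nil.prems show ?case
    by (cases ds) auto
next
  case (Cons c cs)
  have sums: "sum_list ds = c + sum_list cs"
    using Cons.prems(3) length_layered by (metis sum_list.Cons)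
  then obtain d ds' where ds: "ds = d # ds'"
    using Cons.prems(1) by (cases ds) auto
  have "hd (layered (c # cs)) = Suc (sum_list cs)" "hd (layered ds) = Suc (sum_list ds')"
    using Cons.prems(1,2) by (simp_all add: ds layered_Cons upt_rec)
  then have same_tail_sum: "sum_list cs = sum_list ds'"
    using Cons.prems(3) by simp
  with sums have "c = d"
    by (simp add: ds)
  moreover from this have "layered cs = layered ds'"
    using Cons.prems(3) same_tail_sum unfolding ds layered_Cons by simp
  ultimately show ?case
    using Cons.IH[of ds'] Cons.prems(1,2) by (simp add: ds)
qed

text \<open>
  The entries up to the maximum \<open>n\<close> must increase, since a descent before \<open>n\<close> would complete to
  213, and they exceed all entries after \<open>n\<close>, since a larger later entry would complete to 132.
  They therefore form an interval ending in \<open>n\<close>, which is the first layer.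
\<close>

lemma no_excursion_imp_layered:
  assumes "no_excursion w" "distinct w" "set w = {1..length w}"
  shows "\<exists>cs. composition_of cs (length w) \<and> w = layered cs"
  using assms
proof (induction "length w" arbitrary: w rule: less_induct)
  case less
  show ?case
  proof (cases "w = []")
    case True
    then have "composition_of [] (length w) \<and> w = layered []"
      by (simp add: composition_of_def)
    then show ?thesis ..
  next
    case False
    define n where "n = length w"
    have "n \<in> set w"
      using False less.prems(3) by (simp add: n_def Suc_le_eq)
    then obtain us vs where w: "w = us @ n # vs"
      by (meson split_list)
    have range: "x < n" if "x \<in> set us \<union> set vs" for x
    proof -
      have "x \<in> set w"
        using that w by auto
      then have "x \<in> {1..n}"
        using less.prems(3) by (simp add: n_def)
      moreover have "x \<noteq> n"
        using that w less.prems(2) by auto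
      ultimately show ?thesis
        by simp
    qed
    have separated: "v < u" if "u \<in> set us" "v \<in> set vs" for u v
    proof (rule ccontr)
      assume "\<not> v < u"
      then have "u < v"
        using that w less.prems(2) by (cases "u = v") auto
      moreover have "subseq ([u] @ [n] @ [v]) w"
        unfolding w using that by (intro list_emb_append_mono) (auto simp: subseq_singleton_left)
      ultimately have "n \<le> v"
        using less.prems(1) unfolding no_excursion_def by auto
      then show False
        using range that(2) by fastforce
    qed
    have "sorted us"
      unfolding sorted_iff_nth_mono_less
    proof (intro allI impI)
      fix i j
      assume ij: "i < j" "j < length us"
      have "us = take i us @ us ! i # drop (Suc i) us"
        using ij by (simp add: id_take_nth_drop)
      moreover have "us ! j \<in> set (drop (Suc i) us)"
        using ij by (auto simp: set_conv_nth intro!: exI[of _ "j - Suc i"])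
      ultimately have "subseq [us ! i, us ! j] us"
        by (metis list_emb_append2 subseq_Cons2_iff subseq_singleton_left)
      then have "subseq ([us ! i, us ! j] @ [n]) w"
        unfolding w by (intro list_emb_append_mono) auto
      moreover have "us ! i < n"
        using range ij by simp
      ultimately show "us ! i \<le> us ! j"
        using less.prems(1) unfolding no_excursion_def by auto
    qed
    define q where "q = length vs"
    define a where "a = Suc (length us)"
    have n_split: "n = q + a"
      using arg_cong[OF w, of length] by (simp add: n_def[symmetric] q_def a_def)
    have set_w: "set us \<union> {n} \<union> set vs = {1..n}"
      using less.prems(3)[folded n_def] by (auto simp: w)
    \<comment> \<open>Everything after \<open>n\<close> is smaller than everything before it, so the entries after \<open>n\<close> form
      an initial segment of \<open>{1..n}\<close>.\<close>
    have "set vs = {1..q}"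
    proof -
      have closed: "y \<in> set vs" if "x \<in> set vs" "1 \<le> y" "y \<le> x" for x y
      proof -
        have "y \<in> {1..n}"
          using that range[of x] by simp
        then have "y \<in> set us \<or> y = n \<or> y \<in> set vs"
          using set_w by blast
        then show ?thesis
          using that range[of x] separated[of y x] by auto
      qed
      have card_vs: "card (set vs) = q"
        using less.prems(2) by (simp add: w q_def distinct_card)
      have pos: "1 \<le> x" if "x \<in> set vs" for x
        using that set_w by auto
      have "set vs \<subseteq> {1..q}"
      proof
        fix x
        assume x: "x \<in> set vs"
        then have "{1..x} \<subseteq> set vs"
          using closed by auto
        then have "card {1..x} \<le> card (set vs)"
          by (intro card_mono) auto
        then show "x \<in> {1..q}"
          using card_vs pos x by simp
      qed
      then show ?thesis
        using card_vs by (intro card_subset_eq) auto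
    qed
    have "set us \<inter> set vs = {}" "n \<notin> set us \<union> set vs"
      using less.prems(2) by (auto simp: w)
    then have "set (us @ [n]) = {1..n} - set vs"
      using set_w by auto
    also have "\<dots> = set [Suc q..<Suc (q + a)]"
      by (auto simp: \<open>set vs = {1..q}\<close> n_split simp del: upt_Suc)
    finally have "us @ [n] = [Suc q..<Suc (q + a)]"
      using \<open>sorted us\<close> range less.prems(2)
      by (intro sorted_distinct_set_unique)
         (auto simp: w sorted_append less_imp_le simp del: upt_Suc)
    then have w_eq: "w = [Suc q..<Suc (q + a)] @ vs"
      unfolding w by (metis append.assoc append_Cons append_Nil)
    have "subseq vs w"
      unfolding w_eq by auto
    then have "no_excursion vs"
      using less.prems(1) no_excursion_subseq by blast
    moreover have "length vs < length w" "distinct vs" "set vs = {1..length vs}"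
      using less.prems(2) \<open>set vs = {1..q}\<close> by (simp_all add: w q_def)
    ultimately obtain cs where cs: "composition_of cs q" "vs = layered cs"
      using less.hyps[of vs] unfolding q_def by blast
    have "composition_of (a # cs) (length w)" "w = layered (a # cs)"
      using cs n_split unfolding w_eq layered_Cons
      by (auto simp: composition_of_def a_def simp del: upt_Suc)
    then show ?thesis
      by blast
  qed
qed

section \<open>Avoiding permutations and their layers\<close>

lemma length_one_line [simp]: "length (one_line n \<pi>) = n"
  by (simp add: one_line_def del: upt_Suc)

lemma one_line_nth: "i < n \<Longrightarrow> one_line n \<pi> ! i = \<pi> (Suc i)"
  by (simp add: one_line_def del: upt_Suc)

lemma one_line_inj:
  assumes "\<pi> permutes {1..n}" "\<sigma> permutes {1..n}" "one_line n \<pi> = one_line n \<sigma>"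
  shows "\<pi> = \<sigma>"
proof
  fix i
  show "\<pi> i = \<sigma> i"
  proof (cases "i \<in> {1..n}")
    case True
    then show ?thesis
      using assms(3) one_line_nth[of "i - 1" n] by (metis Suc_diff_1 Suc_le_lessD
        atLeastAtMost_iff lessI less_le_trans One_nat_def)
  next
    case False
    then show ?thesis
      using assms(1,2) by (simp add: permutes_def)
  qed
qed

lemma avoiding_perms_iff:
  "\<pi> \<in> avoiding_perms n {[1, 3, 2], [2, 1, 3]} \<longleftrightarrow>
     \<pi> permutes {1..n} \<and> no_excursion (one_line n \<pi>)"
  unfolding avoiding_perms_def mem_Collect_eq avoids_both_iff_no_excursion ..

lemma avoiding_perm_layered:
  assumes "\<pi> \<in> avoiding_perms n {[1, 3, 2], [2, 1, 3]}"
  shows "\<exists>cs. composition_of cs n \<and> one_line n \<pi> = layered cs"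
proof -
  have "\<pi> permutes {1..n}" "no_excursion (one_line n \<pi>)"
    using assms unfolding avoiding_perms_iff by simp_all
  moreover from this have "distinct (one_line n \<pi>)"
    by (auto simp: one_line_def distinct_map permutes_inj_on simp del: upt_Suc)
  moreover have "set (one_line n \<pi>) = \<pi> ` {1..n}"
    by (auto simp: one_line_def simp del: upt_Suc)
  ultimately show ?thesis
    using no_excursion_imp_layered[of "one_line n \<pi>"] by (simp add: permutes_image)
qed

lemma kappa_eqD:
  assumes "\<pi> \<in> avoiding_perms n {[1, 3, 2], [2, 1, 3]}" "kappa n \<pi> = cs"
  shows "composition_of cs n \<and> one_line n \<pi> = layered cs"
proof -
  have "\<exists>!cs. composition_of cs n \<and> one_line n \<pi> = layered cs"
    using avoiding_perm_layered[OF assms(1)] layered_inj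
    unfolding composition_of_def by metis
  then show ?thesis
    using assms(2) theI'[of "\<lambda>cs. composition_of cs n \<and> one_line n \<pi> = layered cs"]
    unfolding kappa_def layered_def by blast
qed

text \<open>
  Each boundary between layers is a descent. If there are at least three layers, beginning with
  \<open>a, b\<close>, then \<open>a\<close> and \<open>a + b\<close> are two such boundaries.
\<close>

lemma grassmannian_layered_length:
  assumes "one_line n \<pi> = layered cs" "composition_of cs n" "grassmannian n \<pi>"
  shows "length cs \<le> 2"
proof (rule ccontr)
  assume "\<not> length cs \<le> 2"
  then obtain a b c ds where cs: "cs = a # b # c # ds"
    by (cases cs rule: list.exhaust; cases "tl cs" rule: list.exhaust;
        cases "tl (tl cs)" rule: list.exhaust) auto
  define s where "s = sum_list ds"
  have pos: "a > 0" "b > 0" "c > 0" and n: "n = a + b + c + s"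
    using assms(2) by (auto simp: cs composition_of_def s_def)
  have \<pi>: "\<pi> i = layered cs ! (i - 1)" if "1 \<le> i" "i \<le> n" for i
    using that one_line_nth[of "i - 1" n \<pi>] assms(1) by simp
  have "\<pi> a = n" "\<pi> (Suc a) = Suc (c + s)" "\<pi> (a + b) = b + c + s" "\<pi> (Suc (a + b)) = Suc s"
    using pos by (auto simp: \<pi> n cs layered_Cons nth_append s_def[symmetric] del: upt_Suc)
  then have "{a, a + b} \<subseteq> descents n \<pi>"
    using pos n by (auto simp: descents_def)
  moreover have "finite (descents n \<pi>)"
    by (rule finite_subset[of _ "{..n}"]) (auto simp: descents_def)
  ultimately have "card {a, a + b} \<le> card (descents n \<pi>)"
    by (intro card_mono)
  then show False
    using assms(3) pos by (simp add: grassmannian_def)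
qed

section \<open>Rotations\<close>

definition rotation :: "nat \<Rightarrow> nat \<Rightarrow> nat \<Rightarrow> nat" where
  "rotation n b i = (if i \<in> {1..n} then Suc ((i - 1 + b) mod n) else i)"

lemma rotation_Suc: "i < n \<Longrightarrow> rotation n b (Suc i) = Suc ((i + b) mod n)"
  by (simp add: rotation_def)

lemma rotation_permutes: "rotation n b permutes {1..n}"
proof (rule bij_imp_permutes)
  have "inj_on (rotation n b) {1..n}"
  proof (rule inj_onI)
    fix i j
    assume ij: "i \<in> {1..n}" "j \<in> {1..n}" "rotation n b i = rotation n b j"
    then have "[i - 1 + b = j - 1 + b] (mod n)"
      by (simp add: rotation_def cong_def)
    then have "[i - 1 = j - 1] (mod n)"
      by (simp only: cong_add_rcancel_nat)
    moreover have "i - 1 < n" "j - 1 < n"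
      using ij(1,2) by auto
    ultimately have "i - 1 = j - 1"
      by (simp add: cong_less_modulus_unique_nat)
    then show "i = j"
      using ij(1,2) by (auto simp: le_Suc_eq dest: diff_eq_diff_eq)
  qed
  moreover have "rotation n b ` {1..n} \<subseteq> {1..n}"
    by (auto simp: rotation_def Suc_le_eq)
  ultimately show "bij_betw (rotation n b) {1..n} {1..n}"
    by (simp add: bij_betw_def endo_inj_surj)
qed (auto simp: rotation_def)

lemma one_line_rotation:
  assumes "b \<le> n"
  shows "one_line n (rotation n b) = [Suc b..<Suc n] @ [1..<Suc b]"
proof (rule nth_equalityI)
  fix i
  assume "i < length (one_line n (rotation n b))"
  then have "i < n"
    by simp
  then have "(i + b) mod n = (if i < n - b then i + b else i + b - n)"
    using assms by (auto simp: mod_if)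
  then show "one_line n (rotation n b) ! i = ([Suc b..<Suc n] @ [1..<Suc b]) ! i"
    using \<open>i < n\<close> assms
    by (auto simp: one_line_nth rotation_Suc nth_append simp del: upt_Suc)
qed (use assms in \<open>simp del: upt_Suc\<close>)

lemma one_line_rotation_two_layers:
  "one_line (a + b) (rotation (a + b) b) = layered [a, b]"
  by (simp add: one_line_rotation layered_Cons add.commute del: upt_Suc)

lemma one_line_rotation_one_layer: "one_line n (rotation n n) = layered [n]"
  by (simp add: one_line_rotation layered_Cons del: upt_Suc)

lemma rotation_avoiding:
  assumes "b \<le> n"
  shows "rotation n b \<in> avoiding_perms n {[1, 3, 2], [2, 1, 3]}"
proof -
  have "one_line n (rotation n b) = layered [n - b, b]"
    using one_line_rotation_two_layers[of "n - b" b] assms by simp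
  then show ?thesis
    using no_excursion_layered rotation_permutes unfolding avoiding_perms_iff by simp
qed

lemma funpow_rotation:
  assumes "i < n"
  shows "(rotation n b ^^ k) (Suc i) = Suc ((i + k * b) mod n)"
proof (induction k)
  case (Suc k)
  have "((i + k * b) mod n + b) mod n = (i + Suc k * b) mod n"
    by (simp add: mod_simps ac_simps)
  then show ?case
    using Suc assms by (simp add: rotation_Suc)
qed (use assms in simp)

text \<open>
  The orbit of 1 consists of the residues of the multiples of \<open>b\<close>, so it is everything exactly
  if \<open>b\<close> is invertible modulo \<open>n\<close>.
\<close>

lemma cyclic_rotation_iff:
  assumes "n \<ge> 2"
  shows "cyclic_on (rotation n b) {1..n} \<longleftrightarrow> coprime b n"
proof
  assume "cyclic_on (rotation n b) {1..n}"
  then have "{1..n} = orbit (rotation n b) (Suc 0)"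
    using assms by (simp add: cyclic_on_alldef)
  \<comment> \<open>An exponent \<open>k\<close> that takes 1 to 2 is an inverse of \<open>b\<close>.\<close>
  moreover have "2 \<in> {1..n}"
    using assms by simp
  ultimately obtain k where "(rotation n b ^^ k) (Suc 0) = 2"
    unfolding orbit_altdef by force
  then have "(k * b) mod n = 1"
    using assms by (simp add: funpow_rotation)
  then have "[b * k = 1] (mod n)"
    using assms by (simp add: cong_def mult.commute)
  then show "coprime b n"
    by (metis coprime_iff_invertible_nat One_nat_def)
next
  assume "coprime b n"
  then obtain k where k: "[b * k = 1] (mod n)"
    by (metis cong_solve_coprime_nat One_nat_def)
  have "{1..n} = orbit (rotation n b) (Suc 0)"
  proof
    show "orbit (rotation n b) (Suc 0) \<subseteq> {1..n}"
      using assms by (auto simp: orbit_altdef funpow_rotation Suc_le_eq)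
    show "{1..n} \<subseteq> orbit (rotation n b) (Suc 0)"
    proof
      fix i
      assume "i \<in> {1..n}"
      then obtain j where j: "i = Suc j" "j < n"
        by (cases i) auto
      \<comment> \<open>The exponent \<open>k * j\<close> takes 1 to \<open>Suc j\<close>; adding \<open>n\<close> makes it positive, as the
        orbit consists of the images under positive powers.\<close>
      have "[(k * j + n) * b = (b * k) * j + n * b] (mod n)"
        by (simp add: algebra_simps)
      also have "[(b * k) * j + n * b = 1 * j + 0] (mod n)"
        using k by (intro cong_add cong_mult cong_refl) (simp_all add: cong_def)
      finally have "((k * j + n) * b) mod n = j"
        using j(2) by (simp add: cong_def)
      then have "(rotation n b ^^ (k * j + n)) (Suc 0) = i"
        using assms j(1) by (simp add: funpow_rotation)
      moreover have "0 < k * j + n"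
        using assms by simp
      ultimately show "i \<in> orbit (rotation n b) (Suc 0)"
        unfolding orbit_altdef by blast
    qed
  qed
  moreover have "Suc 0 \<in> {1..n}"
    using assms by simp
  ultimately show "cyclic_on (rotation n b) {1..n}"
    unfolding cyclic_on_def by blast
qed

lemma grassmannian_rotation:
  assumes "b \<le> n"
  shows "grassmannian n (rotation n b)"
proof -
  have "descents n (rotation n b) \<subseteq> {n - b}"
  proof
    fix i
    assume "i \<in> descents n (rotation n b)"
    then obtain j where j: "i = Suc j" "Suc j < n"
      and desc: "(Suc j + b) mod n < (j + b) mod n"
      by (cases i) (auto simp: descents_def rotation_Suc)
    then show "i \<in> {n - b}"
      using assms by (auto simp: mod_if split: if_splits)
  qed
  then have "card (descents n (rotation n b)) \<le> card {n - b}"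
    by (intro card_mono) auto
  then show ?thesis
    by (simp add: grassmannian_def)
qed

lemma inj_on_rotation:
  assumes "n \<ge> 2"
  shows "inj_on (rotation n) (totatives n)"
proof (rule inj_onI)
  fix b c
  assume *: "b \<in> totatives n" "c \<in> totatives n" "rotation n b = rotation n c"
  then have "b < n" "c < n"
    using assms totatives_less by auto
  moreover have "rotation n b (Suc 0) = rotation n c (Suc 0)"
    using *(3) by simp
  ultimately show "b = c"
    by (simp add: rotation_Suc)
qed

lemma grassmannian_cyclic_eq_rotations:
  assumes "n \<ge> 2"
  shows "{\<pi> \<in> cyclic_avoiding_perms n {[1, 3, 2], [2, 1, 3]}. grassmannian n \<pi>} =
         rotation n ` totatives n"
proof (intro set_eqI iffI)
  fix \<pi>
  assume "\<pi> \<in> {\<pi> \<in> cyclic_avoiding_perms n {[1, 3, 2], [2, 1, 3]}. grassmannian n \<pi>}"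
  then have \<pi>: "\<pi> \<in> avoiding_perms n {[1, 3, 2], [2, 1, 3]}" "cyclic_on \<pi> {1..n}"
      "grassmannian n \<pi>"
    by (simp_all add: cyclic_avoiding_perms_def)
  obtain cs where cs: "composition_of cs n" "one_line n \<pi> = layered cs"
    using avoiding_perm_layered[OF \<pi>(1)] by blast
  have "length cs \<le> 2"
    using grassmannian_layered_length cs \<pi>(3) by blast
  then consider "cs = []" | a where "cs = [a]" | a b where "cs = [a, b]"
    by (cases cs rule: list.exhaust; cases "tl cs" rule: list.exhaust;
        cases "tl (tl cs)" rule: list.exhaust) auto
  then obtain b where b: "b \<le> n" "layered cs = one_line n (rotation n b)"
  proof cases
    case 1
    then show ?thesis
      using cs(1) assms by (simp add: composition_of_def)
  next
    case (2 a)
    then have "a = n"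
      using cs(1) by (simp add: composition_of_def)
    then show ?thesis
      using that[of n] 2 one_line_rotation_one_layer by simp
  next
    case (3 a b)
    then have "n = a + b"
      using cs(1) by (simp add: composition_of_def)
    then show ?thesis
      using that[of b] 3 one_line_rotation_two_layers by simp
  qed
  then have \<pi>_eq: "\<pi> = rotation n b"
    using one_line_inj[OF _ rotation_permutes] \<pi>(1) cs(2) unfolding avoiding_perms_iff by simp
  then have "coprime b n"
    using \<pi>(2) cyclic_rotation_iff[OF assms] by simp
  moreover from this have "b > 0"
    using assms by (cases "b = 0") auto
  ultimately have "b \<in> totatives n"
    using b(1) by (simp add: in_totatives_iff)
  then show "\<pi> \<in> rotation n ` totatives n"
    using \<pi>_eq by blast
next
  fix \<pi>
  assume "\<pi> \<in> rotation n ` totatives n"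
  then obtain b where "\<pi> = rotation n b" "b \<le> n" "coprime b n"
    by (auto simp: in_totatives_iff)
  then show "\<pi> \<in> {\<pi> \<in> cyclic_avoiding_perms n {[1, 3, 2], [2, 1, 3]}. grassmannian n \<pi>}"
    using rotation_avoiding grassmannian_rotation cyclic_rotation_iff[OF assms]
    by (simp add: cyclic_avoiding_perms_def)
qed

lemma cyclic_two_layers_iff:
  assumes "n \<ge> 2" "\<pi> \<in> avoiding_perms n {[1, 3, 2], [2, 1, 3]}" "kappa n \<pi> = [a, b]"
  shows "\<pi> \<in> cyclic_avoiding_perms n {[1, 3, 2], [2, 1, 3]} \<longleftrightarrow> gcd a b = 1"
proof -
  have n: "n = a + b" and word: "one_line n \<pi> = layered [a, b]"
    using kappa_eqD[OF assms(2,3)] by (simp_all add: composition_of_def)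
  have "\<pi> = rotation n b"
    using one_line_inj[OF _ rotation_permutes] assms(2) word one_line_rotation_two_layers[of a b]
    unfolding avoiding_perms_iff n by simp
  then have "\<pi> \<in> cyclic_avoiding_perms n {[1, 3, 2], [2, 1, 3]} \<longleftrightarrow> coprime b (a + b)"
    using assms(1,2) cyclic_rotation_iff[OF assms(1)] by (simp add: cyclic_avoiding_perms_def n)
  also have "\<dots> \<longleftrightarrow> gcd a b = 1"
    unfolding coprime_iff_gcd_eq_1 gcd.commute[of b "a + b"] gcd_add1 ..
  finally show ?thesis .
qed

theorem theorem5p1:
  fixes n :: nat
  assumes "n \<ge> 2"
  shows "(\<forall>\<pi> \<in> avoiding_perms n {[1,3,2], [2,1,3]}. \<forall>a\<^sub>1 a\<^sub>2. kappa n \<pi> = [a\<^sub>1, a\<^sub>2] \<longrightarrow>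
            (\<pi> \<in> cyclic_avoiding_perms n {[1,3,2], [2,1,3]} \<longleftrightarrow> gcd a\<^sub>1 a\<^sub>2 = 1))
       \<and> card {\<pi> \<in> cyclic_avoiding_perms n {[1,3,2], [2,1,3]}. grassmannian n \<pi>} = totient n"
proof (intro conjI ballI allI impI)
  fix \<pi> a\<^sub>1 a\<^sub>2
  assume "\<pi> \<in> avoiding_perms n {[1,3,2], [2,1,3]}" "kappa n \<pi> = [a\<^sub>1, a\<^sub>2]"
  then show "\<pi> \<in> cyclic_avoiding_perms n {[1,3,2], [2,1,3]} \<longleftrightarrow> gcd a\<^sub>1 a\<^sub>2 = 1"
    by (rule cyclic_two_layers_iff[OF assms])
next
  show "card {\<pi> \<in> cyclic_avoiding_perms n {[1,3,2], [2,1,3]}. grassmannian n \<pi>} = totient n"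
    unfolding grassmannian_cyclic_eq_rotations[OF assms] card_image[OF inj_on_rotation[OF assms]]
    by (rule totient_def[symmetric])
qed

end
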